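(* Suppose $G\in\Omega(\bar q)$ satisfies the following condition: for any $i_1\neq i_2$ in $\{1,\dots,k\}$ and any $j_1\ne j_2$ in $\{1,\dots,\ell\}$, $$V(g_{i_1j_2})\cap V(g_{i_2j_1})=\emptyset .$$ Then $k+\ell\ge N(G)+\chi(G)$, and hence $\mathcal F_G$ is the singleton $\{\bar q\}$.
   Context: Notation: $\mathbb{R}_+^k$ and $\mathbb{R}_{++}^k$ are the vectors in $\mathbb{R}^k$ with all coordinates $\ge 0$, respectively $>0$. Economy. $X\subset\mathbb{R}^m$ is compact and convex. There are $k$ goods, good $i$ being supplied at a point $x_i\in X$, and $\ell$ consumers, consumer $j$ being located at $y_j\in X$ (all these points distinct). Consumer $j$ has a utility function $u_j:\mathbb{R}_+^k\to\mathbb{R}$ that is continuous, concave and increasing ($u_j(q')>u_j(q)$ whenever $q'_i>q_i$ for all $i$), a wealth $w_j>0$ and a price vector $p_j=(p_{1j},\dots,p_{kj})\in\mathbb{R}_{++}^k$. Fix for each $j$ a maximizer $\bar q_j=(\bar q_{1j},\dots,\bar q_{kj})$ of $u_j(q_j)$ over $\{q_j\in\mathbb{R}_+^k: p_j\cdot q_j\le w_j\}$, and let $\bar q=(\bar q_{ij})_{k\times\ell}$, normalized so that $\sum_{i,j}\bar q_{ij}=1$. Put $m_i=\sum_j\bar q_{ij}$, $n_j=\sum_i\bar q_{ij}$ (all positive), $\mathbf a=\sum_i m_i\delta_{x_i}$, $\mathbf b=\sum_j n_j\delta_{y_j}$. $\mathcal P(X\times X)$ denotes probability measures $q=\sum_{i,j}q_{ij}\delta_{(x_i,y_j)}$,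 identified with nonnegative $k\times\ell$ matrices of total sum 1; $q_j=(q_{1j},\dots,q_{kj})$ is the $j$-th column. Transport paths. A transport path $G$ from $\mathbf a$ to $\mathbf b$ is a finite weighted directed graph with vertex set $V(G)\subset X$ containing all $x_i,y_j$, directed edges $e\in E(G)$ which are line segments from $e^-$ to $e^+$, and weights $w(e)>0$, such that for every vertex $v$, $\sum_{e^-=v}w(e)=\sum_{e^+=v}w(e)+c_v$, where $c_v=m_i$ if $v=x_i$, $c_v=-n_j$ if $v=y_j$, and $c_v=0$ otherwise. It is assumed that for each $(i,j)$ there is at most one directed curve $g_{ij}$ from $x_i$ to $y_j$ in $G$, i.e. at most one list of distinct vertices starting at $x_i$ and ending at $y_j$ whose consecutive members are joined by directed edges of $G$; $V(g_{ij})$ denotes this set of vertices (empty if $g_{ij}$ does not exist), and $e\subseteq g_{ij}$ means that the edge $e$ lies on this curve. A matrix $q\in\mathcal P(X\times X)$ is compatible with $G$ if $q_{ij}=0$ whenever $g_{ij}$ does not exist and $\sum_{(i,j):e\subseteq g_{ij}}q_{ij}=w(e)$ for every $e\in E(G)$. $\Omega(\bar q)$ is the set of transport paths $G$ from $\mathbf a$ to $\mathbf b$ with which $\bar q$ is compatible. For $G\in\Omega(\bar q)$, $\mathcal F_G$ is the set of $q\in\mathcal P(X\times X)$ compatible with $G$ with $u_j(q_j)\ge u_j(\bar q_j)$ for all $j$. $N(G)$ is the number of pairs $(i,j)$ for which $g_{ij}$ exists, and $\chi(G)=|V(G)|-|E(G)|$ is the Euler characteristic of $G$.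
   Formalization: The formal statement additionally requires every vertex of G to be an end point of an edge; otherwise the inequality fails, e.g. k = ℓ = 1 with one edge from x_1 to y_1 plus one isolated vertex gives N(G)+χ(G) = 3 > 2. *)

theory Defs
  imports "HOL-Analysis.Analysis" "Graph_Theory.Graph_Theory"
begin

text \<open>
  Goods are indexed by a finite type \<open>'k\<close>, consumers by a finite type \<open>'l\<close>, and a
  \<open>k \<times> \<ell>\<close> matrix \<open>q\<close> has type \<open>real^'l^'k\<close>, so that \<open>q $ i $ j\<close> is the amount of good \<open>i\<close>
  shipped to consumer \<open>j\<close> and \<open>column j q\<close> is the bundle of consumer \<open>j\<close>.
\<close>

definition orthant :: "(real^'k) set" where
  "orthant = {q. \<forall>i. 0 \<le> q $ i}"

definition budget_set :: "real^'k \<Rightarrow> real \<Rightarrow> (real^'k) set" where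
  "budget_set p w = {q \<in> orthant. p \<bullet> q \<le> w}"

text \<open>The matrices representing the probability measures \<open>\<Sum> q\<^sub>i\<^sub>j \<delta>\<^bsub>(x\<^sub>i, y\<^sub>j)\<^esub>\<close>.\<close>

definition plans :: "(real^'l^'k) set" where
  "plans = {q. (\<forall>i j. 0 \<le> q $ i $ j) \<and> (\<Sum>i\<in>UNIV. \<Sum>j\<in>UNIV. q $ i $ j) = 1}"

definition supply_mass :: "real^'l^'k \<Rightarrow> 'k \<Rightarrow> real" where
  "supply_mass q i = (\<Sum>j\<in>UNIV. q $ i $ j)"

definition demand_mass :: "real^'l^'k \<Rightarrow> 'l \<Rightarrow> real" where
  "demand_mass q j = (\<Sum>i\<in>UNIV. q $ i $ j)"

locale economy =
  fixes X :: "(real^'m) set"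
    and x :: "'k::finite \<Rightarrow> real^'m"
    and y :: "'l::finite \<Rightarrow> real^'m"
    and u :: "'l \<Rightarrow> real^'k \<Rightarrow> real"
    and w :: "'l \<Rightarrow> real"
    and p :: "'l \<Rightarrow> real^'k"
    and qbar :: "real^'l^'k"
  assumes compact_X: "compact X"
    and convex_X: "convex X"
    and x_in_X: "range x \<subseteq> X"
    and y_in_X: "range y \<subseteq> X"
    and inj_x: "inj x"
    and inj_y: "inj y"
    and x_neq_y: "range x \<inter> range y = {}"
    and utility_continuous: "continuous_on orthant (u j)"
    and utility_concave: "concave_on orthant (u j)"
    and utility_increasing:
      "\<lbrakk>q \<in> orthant; q' \<in> orthant; \<And>i. q $ i < q' $ i\<rbrakk> \<Longrightarrow> u j q < u j q'"
    and wealth_pos: "0 < w j"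
    and price_pos: "0 < p j $ i"
    and qbar_maximizer: "is_arg_max (u j) (\<lambda>q. q \<in> budget_set (p j) (w j)) (column j qbar)"
    and qbar_normalized: "(\<Sum>i\<in>UNIV. \<Sum>j\<in>UNIV. qbar $ i $ j) = 1"
    and supply_pos: "0 < supply_mass qbar i"
    and demand_pos: "0 < demand_mass qbar j"

text \<open>
  An edge is a line segment and hence given by its pair of end points, so a graph
  without parallel edges suffices. Only the values of \<open>wt\<close> on the edges are relevant.
\<close>

record 'v weighted_graph =
  gr :: "'v pair_pre_digraph"
  wt :: "'v \<times> 'v \<Rightarrow> real"

definition curves :: "'v weighted_graph \<Rightarrow> 'v \<Rightarrow> 'v \<Rightarrow> 'v list set" where
  "curves G a b = {c. vpath c (with_proj (gr G)) \<and> hd c = a \<and> last c = b}"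

text \<open>
  In a transport path there is at most one curve from \<open>x i\<close> to \<open>y j\<close>; then the next two
  sets are the vertex set and the edge set of this curve, empty if there is none.
\<close>

definition curve_verts :: "'v weighted_graph \<Rightarrow> 'v \<Rightarrow> 'v \<Rightarrow> 'v set" where
  "curve_verts G a b = (\<Union>c\<in>curves G a b. set c)"

definition curve_arcs :: "'v weighted_graph \<Rightarrow> 'v \<Rightarrow> 'v \<Rightarrow> ('v \<times> 'v) set" where
  "curve_arcs G a b = (\<Union>c\<in>curves G a b. set (vwalk_arcs c))"

text \<open>
  Transport paths in \<open>X\<close> from \<open>\<Sum> m\<^sub>i \<delta>\<^bsub>x\<^sub>i\<^esub>\<close> to \<open>\<Sum> n\<^sub>j \<delta>\<^bsub>y\<^sub>j\<^esub>\<close>. For distinct points the two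
  sums over \<open>{i. x i = v}\<close> and \<open>{j. y j = v}\<close> have at most one term altogether, and their
  difference is \<open>c\<^sub>v\<close>. Every vertex is required to be an end point of an edge: an isolated
  vertex carries no mass, but would increase the Euler characteristic.
\<close>

definition transport_path ::
  "(real^'m) set \<Rightarrow> ('k::finite \<Rightarrow> real^'m) \<Rightarrow> ('k \<Rightarrow> real) \<Rightarrow>
   ('l::finite \<Rightarrow> real^'m) \<Rightarrow> ('l \<Rightarrow> real) \<Rightarrow> (real^'m) weighted_graph \<Rightarrow> bool" where
  "transport_path X x m y n G \<longleftrightarrow>
     pair_digraph (gr G) \<and>
     pverts (gr G) \<subseteq> X \<and> range x \<subseteq> pverts (gr G) \<and> range y \<subseteq> pverts (gr G) \<and>
     pverts (gr G) \<subseteq> fst ` parcs (gr G) \<union> snd ` parcs (gr G) \<and>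
     (\<forall>e\<in>parcs (gr G). 0 < wt G e) \<and>
     (\<forall>v\<in>pverts (gr G).
        (\<Sum>e\<in>out_arcs (with_proj (gr G)) v. wt G e) =
        (\<Sum>e\<in>in_arcs (with_proj (gr G)) v. wt G e)
          + ((\<Sum>i | x i = v. m i) - (\<Sum>j | y j = v. n j))) \<and>
     (\<forall>i j. \<exists>\<^sub>\<le>\<^sub>1 c. c \<in> curves G (x i) (y j))"

definition compatible ::
  "('k::finite \<Rightarrow> 'v) \<Rightarrow> ('l::finite \<Rightarrow> 'v) \<Rightarrow> 'v weighted_graph \<Rightarrow> real^'l^'k \<Rightarrow> bool" where
  "compatible x y G q \<longleftrightarrow>
     q \<in> plans \<and>
     (\<forall>i j. curves G (x i) (y j) = {} \<longrightarrow> q $ i $ j = 0) \<and>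
     (\<forall>e\<in>parcs (gr G).
        (\<Sum>(i, j) | e \<in> curve_arcs G (x i) (y j). q $ i $ j) = wt G e)"

definition Omega ::
  "(real^'m) set \<Rightarrow> ('k::finite \<Rightarrow> real^'m) \<Rightarrow> ('l::finite \<Rightarrow> real^'m) \<Rightarrow> real^'l^'k
     \<Rightarrow> (real^'m) weighted_graph set" where
  "Omega X x y qbar =
     {G. transport_path X x (supply_mass qbar) y (demand_mass qbar) G \<and> compatible x y G qbar}"

definition feasible_plans ::
  "('k::finite \<Rightarrow> 'v) \<Rightarrow> ('l::finite \<Rightarrow> 'v) \<Rightarrow> ('l \<Rightarrow> real^'k \<Rightarrow> real) \<Rightarrow> real^'l^'k
     \<Rightarrow> 'v weighted_graph \<Rightarrow> (real^'l^'k) set" where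
  "feasible_plans x y u qbar G =
     {q. compatible x y G q \<and> (\<forall>j. u j (column j q) \<ge> u j (column j qbar))}"

definition num_curves ::
  "('k::finite \<Rightarrow> 'v) \<Rightarrow> ('l::finite \<Rightarrow> 'v) \<Rightarrow> 'v weighted_graph \<Rightarrow> nat" where
  "num_curves x y G = card {(i, j). curves G (x i) (y j) \<noteq> {}}"

definition euler_char :: "'v weighted_graph \<Rightarrow> int" where
  "euler_char G = int (card (pverts (gr G))) - int (card (parcs (gr G)))"

end

theory Submission
  imports Defs
begin

text \<open>
  Let \<open>f\<^sub>z = \<Sum> z\<^sub>i\<^sub>j 1\<^bsub>g\<^sub>i\<^sub>j\<^esub>\<close> be the flow carried by a matrix \<open>z\<close> supported on the existing curves.
  Summing the increments of a potential \<open>\<phi>\<close> along the curves gives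
  \<open>\<langle>f\<^sub>z, d\<phi>\<rangle> = \<Sum> z\<^sub>i\<^sub>j (\<phi>(y\<^sub>j) - \<phi>(x\<^sub>i))\<close>, so \<open>f\<^sub>z = 0\<close> forces all row and column sums of
  \<open>z\<close> to vanish. If \<open>g\<^sub>i\<^sub>j\<close> is the only curve from \<open>x\<^sub>i\<close> or the only one to \<open>y\<^sub>j\<close>, then \<open>z\<^sub>i\<^sub>j\<close>
  is such a sum. Otherwise take the last vertex \<open>v\<close> of \<open>g\<^sub>i\<^sub>j\<close> lying on another curve from
  \<open>x\<^sub>i\<close>; by the disjointness hypothesis the arc of \<open>g\<^sub>i\<^sub>j\<close> leaving \<open>v\<close> lies on no other curve,
  and \<open>z\<^sub>i\<^sub>j\<close> is the value of \<open>f\<^sub>z\<close> there. Hence \<open>f\<^sub>z = 0\<close> implies \<open>z = 0\<close>, which gives uniqueness.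

  For potentials vanishing at all \<open>x\<^sub>i\<close> and \<open>y\<^sub>j\<close>, the flow \<open>f\<^sub>z\<close> is orthogonal to \<open>d\<phi>\<close>, so the
  linear map \<open>(z, \<phi>) \<mapsto> f\<^sub>z + d\<phi>\<close> is injective as well. Comparing dimensions yields
  \<open>N(G) + (|V(G)| - k - \<ell>) \<le> |E(G)|\<close>.
\<close>

section \<open>Linear algebra: underdetermined homogeneous systems\<close>

lemma underdetermined_system_nontrivial:
  fixes M :: "'b \<Rightarrow> 'a \<Rightarrow> 'f::field"
  assumes "finite B" "finite A" "card B < card A"
  shows "\<exists>c. (\<exists>a\<in>A. c a \<noteq> 0) \<and> (\<forall>b\<in>B. (\<Sum>a\<in>A. M b a * c a) = 0)"
  using assms
proof (induction B arbitrary: A M rule: finite_induct)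
  case empty
  then have "A \<noteq> {}" by auto
  then show ?case by (intro exI[of _ "\<lambda>_. 1"]) auto
next
  case (insert b B)
  show ?case
  proof (cases "\<forall>a\<in>A. M b a = 0")
    case True
    have "card B < card A" using insert by simp
    from insert.IH[OF insert.prems(1) this, of M] True show ?thesis by auto
  next
    case False
    then obtain r where r: "r \<in> A" "M b r \<noteq> 0" by auto
    \<comment> \<open>Gaussian elimination with pivot \<open>r\<close>: \<open>M'\<close> arises by
      clearing column \<open>r\<close> with row \<open>b\<close>, and \<open>d\<close> solves
      equation \<open>b\<close> for the unknown \<open>r\<close>.\<close>
    define A' where "A' = A - {r}"
    define M' where "M' = (\<lambda>b' a. M b' a - M b' r * M b a / M b r)"
    have A': "finite A'" "r \<notin> A'" "A = insert r A'" using insert.prems r by (auto simp: A'_def)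
    then have "card B < card A'" using insert by simp
    from insert.IH[OF A'(1) this, of M'] obtain c where
      c: "\<exists>a\<in>A'. c a \<noteq> 0" "\<And>b'. b' \<in> B \<Longrightarrow> (\<Sum>a\<in>A'. M' b' a * c a) = 0" by auto
    define s where "s = (\<Sum>a\<in>A'. M b a * c a)"
    define d where "d = c(r := - s / M b r)"
    have d: "(\<Sum>a\<in>A. M b' a * d a) = (\<Sum>a\<in>A'. M b' a * c a) - M b' r * s / M b r" for b'
    proof -
      have "(\<Sum>a\<in>A'. M b' a * d a) = (\<Sum>a\<in>A'. M b' a * c a)"
        using A' by (intro sum.cong) (auto simp: d_def)
      then show ?thesis using A' by (simp add: d_def)
    qed
    have "(\<Sum>a\<in>A. M b' a * d a) = 0" if "b' \<in> insert b B" for b'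
    proof (cases "b' = b")
      case True
      then show ?thesis using r by (simp add: d flip: s_def)
    next
      case False
      have "(\<Sum>a\<in>A'. M' b' a * c a) = (\<Sum>a\<in>A'. M b' a * c a) - M b' r * s / M b r"
        by (simp add: M'_def s_def left_diff_distrib sum_subtractf sum_distrib_left
            sum_divide_distrib mult.assoc)
      then show ?thesis using c(2) that False d by simp
    qed
    moreover have "\<exists>a\<in>A. d a \<noteq> 0" using c(1) A' by (auto simp: d_def)
    ultimately show ?thesis by blast
  qed
qed

section \<open>Potentials along directed walks\<close>

lemma vwalk_arcs_endpoints:
  "e \<in> set (vwalk_arcs c) \<Longrightarrow> fst e \<in> set c \<and> snd e \<in> set c"
  by (induction c rule: vwalk_arcs.induct) auto

lemma sum_increments_vwalk_arcs:
  fixes \<phi> :: "'v \<Rightarrow> 'a::ab_group_add"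
  assumes "distinct c" "c \<noteq> []"
  shows "(\<Sum>e\<in>set (vwalk_arcs c). \<phi> (snd e) - \<phi> (fst e)) = \<phi> (last c) - \<phi> (hd c)"
  using assms
proof (induction c rule: vwalk_arcs.induct)
  case (3 a b cs)
  \<comment> \<open>The sum runs over a set of arcs, so telescoping requires that the first arc does
    not recur; distinct vertices guarantee this.\<close>
  then have "(a, b) \<notin> set (vwalk_arcs (b # cs))"
    using vwalk_arcs_endpoints[of "(a, b)" "b # cs"] by auto
  then show ?case using 3 by simp
qed auto

lemma constant_on_vwalk:
  assumes "\<And>e. e \<in> set (vwalk_arcs c) \<Longrightarrow> \<phi> (fst e) = \<phi> (snd e)" "v \<in> set c"
  shows "\<phi> v = \<phi> (hd c)"
  using assms
proof (induction c rule: vwalk_arcs.induct)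
  case (3 a b cs)
  have "\<phi> a = \<phi> b" using "3.prems"(1)[of "(a, b)"] by simp
  moreover have "\<phi> v = \<phi> b" if "v \<in> set (b # cs)"
    using "3.IH"[OF "3.prems"(1) that] by simp
  ultimately show ?case using "3.prems"(2) by auto
qed auto

section \<open>The flow map of a system of curves and its injectivity\<close>

locale curve_system =
  fixes G :: "'v weighted_graph"
    and x :: "'k::finite \<Rightarrow> 'v"
    and y :: "'l::finite \<Rightarrow> 'v"
  assumes finite_arcs: "finite (parcs (gr G))"
    and curve_unique: "\<exists>\<^sub>\<le>\<^sub>1 c. c \<in> curves G (x i) (y j)"
    and inj_x: "inj x"
    and inj_y: "inj y"
    and x_neq_y: "range x \<inter> range y = {}"
    and separated: "\<lbrakk>i \<noteq> i'; j \<noteq> j'\<rbrakk> \<Longrightarrow>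
          curve_verts G (x i) (y j') \<inter> curve_verts G (x i') (y j) = {}"
begin

definition supported :: "('k \<Rightarrow> 'l \<Rightarrow> real) \<Rightarrow> bool" where
  "supported z \<longleftrightarrow> (\<forall>i j. curves G (x i) (y j) = {} \<longrightarrow> z i j = 0)"

text \<open>Negative entries are allowed so that differences of plans can be inserted; for a
  compatible plan the flow on each arc is its weight.\<close>

definition flow :: "('k \<Rightarrow> 'l \<Rightarrow> real) \<Rightarrow> 'v \<times> 'v \<Rightarrow> real" where
  "flow z e = (\<Sum>(i, j) | e \<in> curve_arcs G (x i) (y j). z i j)"

lemma curve_props:
  assumes "c \<in> curves G (x i) (y j)"
  shows "curve_verts G (x i) (y j) = set c" "curve_arcs G (x i) (y j) = set (vwalk_arcs c)"
    "distinct c" "c \<noteq> []" "hd c = x i" "last c = y j" "set (vwalk_arcs c) \<subseteq> parcs (gr G)"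
proof -
  have "curves G (x i) (y j) = {c}"
    using assms curve_unique[of i j] by (auto dest: Uniq_D)
  then show "curve_verts G (x i) (y j) = set c" "curve_arcs G (x i) (y j) = set (vwalk_arcs c)"
    by (simp_all add: curve_verts_def curve_arcs_def)
  show "distinct c" "c \<noteq> []" "hd c = x i" "last c = y j" "set (vwalk_arcs c) \<subseteq> parcs (gr G)"
    using assms by (auto simp: curves_def vpath_def vwalk_def)
qed

text \<open>A fixed index set with an indicator lets the sum over pairs be exchanged with the sum
  over arcs.\<close>

lemma flow_eq: "flow z e = (\<Sum>(i, j)\<in>UNIV. if e \<in> curve_arcs G (x i) (y j) then z i j else 0)"
proof -
  have "flow z e = (\<Sum>ij\<in>{ij. e \<in> curve_arcs G (x (fst ij)) (y (snd ij))}. z (fst ij) (snd ij))"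
    unfolding flow_def by (intro sum.cong) auto
  also have "\<dots> = (\<Sum>ij\<in>UNIV. if e \<in> curve_arcs G (x (fst ij)) (y (snd ij))
      then z (fst ij) (snd ij) else 0)"
    by (subst sum.inter_filter[symmetric]) auto
  finally show ?thesis by (simp add: case_prod_unfold)
qed

lemma sum_flow_increments:
  assumes "supported z"
  shows "(\<Sum>e\<in>parcs (gr G). flow z e * (\<phi> (snd e) - \<phi> (fst e))) =
    (\<Sum>i\<in>UNIV. \<Sum>j\<in>UNIV. z i j * (\<phi> (y j) - \<phi> (x i)))"
proof -
  have curve: "(\<Sum>e\<in>parcs (gr G). (if e \<in> curve_arcs G (x i) (y j) then z i j else 0)
      * (\<phi> (snd e) - \<phi> (fst e))) = z i j * (\<phi> (y j) - \<phi> (x i))" for i j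
  proof (cases "curves G (x i) (y j) = {}")
    case True
    then show ?thesis using assms by (simp add: supported_def curve_arcs_def)
  next
    case False
    then obtain c where c: "c \<in> curves G (x i) (y j)" by auto
    note c' = curve_props[OF c]
    have "(\<Sum>e\<in>parcs (gr G). (if e \<in> curve_arcs G (x i) (y j) then z i j else 0)
        * (\<phi> (snd e) - \<phi> (fst e))) = (\<Sum>e\<in>set (vwalk_arcs c). z i j * (\<phi> (snd e) - \<phi> (fst e)))"
      using c' finite_arcs by (intro sum.mono_neutral_cong_right) auto
    then show ?thesis
      using c' sum_increments_vwalk_arcs[of c \<phi>] by (simp flip: sum_distrib_left)
  qed
  have "(\<Sum>e\<in>parcs (gr G). flow z e * (\<phi> (snd e) - \<phi> (fst e))) =
    (\<Sum>e\<in>parcs (gr G). \<Sum>(i, j)\<in>UNIV. (if e \<in> curve_arcs G (x i) (y j) then z i j else 0)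
      * (\<phi> (snd e) - \<phi> (fst e)))"
    by (simp add: flow_eq sum_distrib_right case_prod_unfold)
  also have "\<dots> = (\<Sum>(i, j)\<in>UNIV. z i j * (\<phi> (y j) - \<phi> (x i)))"
    by (subst sum.swap) (simp add: case_prod_unfold curve)
  finally show ?thesis
    by (simp add: sum.cartesian_product)
qed

lemma row_column_sums_zero:
  assumes "supported z" and "\<And>e. e \<in> parcs (gr G) \<Longrightarrow> flow z e = 0"
  shows "(\<Sum>j\<in>UNIV. z i j) = 0" and "(\<Sum>i\<in>UNIV. z i j) = 0"
proof -
  have zero: "(\<Sum>i\<in>UNIV. \<Sum>j\<in>UNIV. z i j * (\<phi> (y j) - \<phi> (x i))) = 0" for \<phi>
    using sum_flow_increments[OF assms(1), of \<phi>] assms(2) by simp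
  have ne: "x a \<noteq> y b" for a b using x_neq_y by (metis rangeI disjoint_iff)
  \<comment> \<open>The indicator of \<open>x i\<close>, taken as potential, vanishes at all other
    sources and at all sinks, so only row \<open>i\<close> survives, negated. The indicator of
    \<open>y j\<close> isolates column \<open>j\<close> likewise.\<close>
  have "(\<Sum>a\<in>UNIV. \<Sum>b\<in>UNIV. if a = i then - z a b else 0) = 0"
    using zero[of "\<lambda>v. if v = x i then 1 else 0"] ne ne[symmetric] inj_x
    by (simp add: inj_eq if_distrib cong: if_cong)
  also have "(\<Sum>a\<in>UNIV. \<Sum>b\<in>UNIV. if a = i then - z a b else 0) =
      (\<Sum>a\<in>UNIV. if a = i then \<Sum>b\<in>UNIV. - z a b else 0)"
    by (intro sum.cong) auto
  finally show "(\<Sum>j\<in>UNIV. z i j) = 0" by (simp add: sum_negf)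
  show "(\<Sum>i\<in>UNIV. z i j) = 0"
    using zero[of "\<lambda>v. if v = y j then 1 else 0"] ne ne[symmetric] inj_y
    by (simp add: inj_eq mult_delta_right)
qed

lemma ex_exclusive_arc:
  assumes c: "c \<in> curves G (x i) (y j)"
    and row: "j' \<noteq> j" "curves G (x i) (y j') \<noteq> {}"
    and col: "i' \<noteq> i" "curves G (x i') (y j) \<noteq> {}"
  shows "\<exists>e\<in>parcs (gr G). \<forall>a b. e \<in> curve_arcs G (x a) (y b) \<longleftrightarrow> a = i \<and> b = j"
proof -
  note c' = curve_props[OF c]
  define P where "P v \<longleftrightarrow> (\<exists>b. b \<noteq> j \<and> v \<in> curve_verts G (x i) (y b))" for v
  have "P (x i)"
    using row curve_props(1,4,5) by (metis P_def ex_in_conv hd_in_set)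
  then have "\<exists>v\<in>set c. P v" using c' hd_in_set by metis
  from split_list_last_prop[OF this] obtain ps v qs where
    split: "c = ps @ v # qs" "P v" "\<forall>s\<in>set qs. \<not> P s" by blast
  from split(2) obtain b where b: "b \<noteq> j" "v \<in> curve_verts G (x i) (y b)" by (auto simp: P_def)
  have v: "v \<notin> curve_verts G (x a) (y j)" if "a \<noteq> i" for a
    using separated[of i a j b] that b by auto
  \<comment> \<open>\<open>v\<close> avoids all other curves to \<open>y j\<close>, while
    \<open>y j\<close> lies on one of them; so \<open>v\<close> is not the end of \<open>c\<close>
    and has a successor on it.\<close>
  have "y j \<in> curve_verts G (x i') (y j)"
    using col curve_props(1,4,6) by (metis ex_in_conv last_in_set)
  then have "v \<noteq> y j" using v[OF col(1)] by auto
  then have "qs \<noteq> []" using split c' by auto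
  then obtain s rs where qs: "qs = s # rs" by (cases qs) auto
  have e: "(v, s) \<in> set (vwalk_arcs c)"
    unfolding split qs by (rule subsetD[OF set_vwalk_arcs_append2]) simp
  have "a = i \<and> b = j" if "(v, s) \<in> curve_arcs G (x a) (y b)" for a b
  proof -
    have vs: "v \<in> curve_verts G (x a) (y b)" "s \<in> curve_verts G (x a) (y b)"
      using that vwalk_arcs_endpoints by (fastforce simp: curve_arcs_def curve_verts_def)+
    \<comment> \<open>Other curves from \<open>x i\<close> miss \<open>s\<close> by the choice of
      \<open>v\<close> as last; other curves to \<open>y j\<close> miss \<open>v\<close>; curves
      differing from \<open>c\<close> in both end points are disjoint from it.\<close>
    have "b = j" if "a = i" using vs split(3) that by (auto simp: P_def qs)
    moreover have "b \<noteq> j" if "a \<noteq> i" using v[OF that] vs by auto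
    moreover have "a = i" if "b \<noteq> j"
      using separated[of i a b j] vs that split(1) c'(1) by auto
    ultimately show ?thesis by blast
  qed
  then show ?thesis using e c' by (intro bexI[of _ "(v, s)"]) auto
qed

lemma flow_zero_imp_zero:
  assumes "supported z" and "\<And>e. e \<in> parcs (gr G) \<Longrightarrow> flow z e = 0"
  shows "z i j = 0"
proof (cases "curves G (x i) (y j) = {}")
  case True
  then show ?thesis using assms(1) by (simp add: supported_def)
next
  case False
  then obtain c where c: "c \<in> curves G (x i) (y j)" by auto
  consider "\<And>j'. j' \<noteq> j \<Longrightarrow> curves G (x i) (y j') = {}"
    | "\<And>i'. i' \<noteq> i \<Longrightarrow> curves G (x i') (y j) = {}"
    | i' j' where "j' \<noteq> j" "curves G (x i) (y j') \<noteq> {}" "i' \<noteq> i" "curves G (x i') (y j) \<noteq> {}"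
    by blast
  then show ?thesis
  proof cases
    case 1
    then have "z i j = (\<Sum>j\<in>UNIV. z i j)"
      using assms(1) by (subst sum.remove[of _ j]) (auto simp: supported_def)
    then show ?thesis using row_column_sums_zero(1)[OF assms] by simp
  next
    case 2
    then have "z i j = (\<Sum>i\<in>UNIV. z i j)"
      using assms(1) by (subst sum.remove[of _ i]) (auto simp: supported_def)
    then show ?thesis using row_column_sums_zero(2)[OF assms] by simp
  next
    case 3
    from ex_exclusive_arc[OF c this] obtain e where e: "e \<in> parcs (gr G)"
      "\<And>a b. e \<in> curve_arcs G (x a) (y b) \<longleftrightarrow> a = i \<and> b = j" by blast
    have "{(a, b). e \<in> curve_arcs G (x a) (y b)} = {(i, j)}" using e(2) by auto
    then show ?thesis using assms(2)[OF e(1)] by (simp add: flow_def)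
  qed
qed

section \<open>Dimension count\<close>

lemma flow_plus_increments_zero:
  assumes z: "supported z"
    and \<phi>: "\<And>i. \<phi> (x i) = 0" "\<And>j. \<phi> (y j) = 0"
    and zero: "\<And>e. e \<in> parcs (gr G) \<Longrightarrow> flow z e + (\<phi> (snd e) - \<phi> (fst e)) = 0"
    and v: "v \<in> curve_verts G (x a) (y b)"
  shows "z i j = 0" "\<phi> v = 0"
proof -
  \<comment> \<open>On arcs the flow is minus the increment of \<phi>, to which it is also
    orthogonal; hence its squared norm is zero.\<close>
  have "(\<Sum>e\<in>parcs (gr G). flow z e * flow z e) =
      - (\<Sum>e\<in>parcs (gr G). flow z e * (\<phi> (snd e) - \<phi> (fst e)))"
    unfolding sum_negf[symmetric]
  proof (intro sum.cong refl)
    fix e assume "e \<in> parcs (gr G)"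
    then have "\<phi> (snd e) - \<phi> (fst e) = - flow z e" using zero[of e] by linarith
    then show "flow z e * flow z e = - (flow z e * (\<phi> (snd e) - \<phi> (fst e)))"
      by simp
  qed
  also have "\<dots> = 0" using sum_flow_increments[OF z, of \<phi>] \<phi> by simp
  finally have flow: "flow z e = 0" if "e \<in> parcs (gr G)" for e
    using that finite_arcs by (simp add: sum_nonneg_eq_0_iff)
  then show "z i j = 0" by (rule flow_zero_imp_zero[OF z])
  from v obtain c where c: "c \<in> curves G (x a) (y b)" "v \<in> set c"
    by (auto simp: curve_verts_def)
  \<comment> \<open>With zero flow, \<phi> has no increments on arcs and keeps along
    \<open>c\<close> its value 0 at the source.\<close>
  have "\<phi> v = \<phi> (hd c)"
    using c curve_props(7)[OF c(1)] zero flow by (intro constant_on_vwalk) force+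
  then show "\<phi> v = 0" using curve_props(5)[OF c(1)] \<phi> by simp
qed

lemma num_curves_bound:
  assumes fin: "finite (pverts (gr G))"
    and terminals: "range x \<subseteq> pverts (gr G)" "range y \<subseteq> pverts (gr G)"
    and covered: "pverts (gr G) \<subseteq> (\<Union>i j. curve_verts G (x i) (y j))"
  shows "int (num_curves x y G) + euler_char G \<le> int CARD('k) + int CARD('l)"
proof -
  define S where "S = {(i, j). curves G (x i) (y j) \<noteq> {}}"
  define W where "W = pverts (gr G) - (range x \<union> range y)"
  have "card (range x \<union> range y) = CARD('k) + CARD('l)"
    using x_neq_y inj_x inj_y by (simp add: card_Un_disjoint card_image)
  moreover have "card W = card (pverts (gr G)) - card (range x \<union> range y)"
    "card (range x \<union> range y) \<le> card (pverts (gr G))"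
    using terminals fin unfolding W_def by (auto intro!: card_Diff_subset card_mono)
  ultimately have W: "int (card W) = int (card (pverts (gr G))) - int CARD('k) - int CARD('l)"
    by simp
  have finW: "finite W" using fin by (simp add: W_def)
  have "card (S <+> W) \<le> card (parcs (gr G))"
  proof (rule ccontr)
    \<comment> \<open>Matrix of \<open>(z, \<phi>) \<mapsto> flow z + d\<phi>\<close>: a curve
      contributes the indicator of its arcs, a vertex in \<open>W\<close> the increments of its own
      indicator.\<close>
    define M where "M = (\<lambda>e. case_sum
      (\<lambda>(i, j). if e \<in> curve_arcs G (x i) (y j) then 1 else 0)
      (\<lambda>v. of_bool (snd e = v) - of_bool (fst e = v) :: real))"
    assume "\<not> card (S <+> W) \<le> card (parcs (gr G))"
    then obtain c where c: "\<exists>a\<in>S <+> W. c a \<noteq> 0"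
      "\<And>e. e \<in> parcs (gr G) \<Longrightarrow> (\<Sum>a\<in>S <+> W. M e a * c a) = 0"
      using underdetermined_system_nontrivial[of "parcs (gr G)" "S <+> W" M] finite_arcs finW
      by auto
    \<comment> \<open>Extension by zero makes \<open>z\<close> supported and lets \<phi> vanish at
      all sources and sinks.\<close>
    define z where "z i j = (if (i, j) \<in> S then c (Inl (i, j)) else 0)" for i j
    define \<phi> where "\<phi> v = (if v \<in> W then c (Inr v) else 0)" for v
    have z: "supported z" by (simp add: supported_def z_def S_def)
    have \<phi>: "\<phi> (x i) = 0" "\<phi> (y j) = 0" for i j by (auto simp: \<phi>_def W_def)
    have zero: "flow z e + (\<phi> (snd e) - \<phi> (fst e)) = 0" if "e \<in> parcs (gr G)" for e
    proof -
      have "(\<Sum>a\<in>S. M e (Inl a) * c (Inl a)) = flow z e"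
        unfolding flow_eq using finite[of S]
        by (intro sum.mono_neutral_cong_left) (auto simp: M_def z_def)
      moreover have "(\<Sum>v\<in>W. M e (Inr v) * c (Inr v)) = \<phi> (snd e) - \<phi> (fst e)"
        using finW by (simp add: M_def \<phi>_def left_diff_distrib sum_subtractf of_bool_def
            if_distrib[of "\<lambda>t. t * _"] cong: if_cong)
      moreover have "(\<Sum>a\<in>S <+> W. M e a * c a) =
          (\<Sum>a\<in>S. M e (Inl a) * c (Inl a)) + (\<Sum>v\<in>W. M e (Inr v) * c (Inr v))"
        using finW by (subst sum.Plus) auto
      ultimately show ?thesis using c(2)[OF that] by simp
    qed
    \<comment> \<open>The preceding lemma speaks of a vertex on some curve; a source with arbitrary
      index provides one.\<close>
    have "x undefined \<in> (\<Union>i j. curve_verts G (x i) (y j))" using terminals covered by blast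
    then have z_zero: "z i j = 0" for i j using flow_plus_increments_zero(1)[OF z \<phi> zero] by blast
    have "c (Inl (i, j)) = 0" if "(i, j) \<in> S" for i j
      using z_zero[of i j] that by (simp add: z_def)
    moreover have "\<phi> v = 0" if "v \<in> W" for v
      using flow_plus_increments_zero(2)[OF z \<phi> zero] that covered by (auto simp: W_def)
    then have "c (Inr v) = 0" if "v \<in> W" for v
      using that by (auto simp: \<phi>_def)
    ultimately have "c a = 0" if "a \<in> S <+> W" for a
      using that by auto
    then show False using c(1) by blast
  qed
  then show ?thesis
    using W finW by (simp add: num_curves_def euler_char_def card_Plus flip: S_def)
qed

text \<open>Both flows equal \<open>wt G\<close> on the arcs, so the difference lies in the trivial
  kernel of \<open>flow\<close>.\<close>

lemma compatible_unique:
  assumes "compatible x y G q" "compatible x y G q'"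
  shows "q = q'"
proof -
  define z where "z i j = q $ i $ j - q' $ i $ j" for i j
  have "supported z" using assms by (simp add: supported_def compatible_def z_def)
  moreover have "flow z e = 0" if "e \<in> parcs (gr G)" for e
  proof -
    have "flow z e = flow (\<lambda>i j. q $ i $ j) e - flow (\<lambda>i j. q' $ i $ j) e"
      by (simp add: flow_def z_def case_prod_unfold sum_subtractf)
    then show ?thesis using assms that by (simp add: flow_def compatible_def)
  qed
  ultimately have "z i j = 0" for i j by (rule flow_zero_imp_zero)
  then show ?thesis by (simp add: z_def vec_eq_iff)
qed

end

section \<open>Application to transport paths\<close>

theorem proposition3p3:
  fixes X :: "(real^'m) set"
    and x :: "'k::finite \<Rightarrow> real^'m"
    and y :: "'l::finite \<Rightarrow> real^'m"
    and u :: "'l \<Rightarrow> real^'k \<Rightarrow> real"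
    and w :: "'l \<Rightarrow> real"
    and p :: "'l \<Rightarrow> real^'k"
    and qbar :: "real^'l^'k"
    and G :: "(real^'m) weighted_graph"
  assumes "economy X x y u w p qbar"
    and "G \<in> Omega X x y qbar"
    and "\<And>i\<^sub>1 i\<^sub>2 j\<^sub>1 j\<^sub>2. i\<^sub>1 \<noteq> i\<^sub>2 \<Longrightarrow> j\<^sub>1 \<noteq> j\<^sub>2 \<Longrightarrow>
           curve_verts G (x i\<^sub>1) (y j\<^sub>2) \<inter> curve_verts G (x i\<^sub>2) (y j\<^sub>1) = {}"
  shows "int CARD('k) + int CARD('l) \<ge> int (num_curves x y G) + euler_char G
       \<and> feasible_plans x y u qbar G = {qbar}"
proof -
  interpret economy X x y u w p qbar by (rule assms(1))
  have G: "transport_path X x (supply_mass qbar) y (demand_mass qbar) G"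
    and qbar: "compatible x y G qbar"
    using assms(2) by (simp_all add: Omega_def)
  then interpret pair_digraph "gr G" by (simp add: transport_path_def)
  interpret curve_system G x y
    using G inj_x inj_y x_neq_y assms(3) pair_finite_arcs
    by unfold_locales (auto simp: transport_path_def)
  \<comment> \<open>On an arc missed by all curves, compatibility would equate a positive weight
    with an empty sum.\<close>
  have arcs_covered: "\<exists>i j. e \<in> curve_arcs G (x i) (y j)" if "e \<in> parcs (gr G)" for e
  proof (rule ccontr)
    assume "\<nexists>i j. e \<in> curve_arcs G (x i) (y j)"
    then have "wt G e = 0" using qbar that by (auto simp: compatible_def)
    then show False using G that by (auto simp: transport_path_def)
  qed
  have "pverts (gr G) \<subseteq> (\<Union>i j. curve_verts G (x i) (y j))"
  proof
    fix v assume "v \<in> pverts (gr G)"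
    then obtain e where e: "e \<in> parcs (gr G)" "v = fst e \<or> v = snd e"
      using G by (auto simp: transport_path_def)
    with arcs_covered obtain i j c where "c \<in> curves G (x i) (y j)" "e \<in> set (vwalk_arcs c)"
      by (fastforce simp: curve_arcs_def)
    with e vwalk_arcs_endpoints show "v \<in> (\<Union>i j. curve_verts G (x i) (y j))"
      by (fastforce simp: curve_verts_def)
  qed
  then have "int (num_curves x y G) + euler_char G \<le> int CARD('k) + int CARD('l)"
    using G pair_finite_verts by (intro num_curves_bound) (auto simp: transport_path_def)
  \<comment> \<open>\<open>qbar\<close> meets its utility bounds with equality, and compatibility
    admits no second plan.\<close>
  moreover have "feasible_plans x y u qbar G = {qbar}"
    using qbar compatible_unique by (auto simp: feasible_plans_def)
  ultimately show ?thesis by simp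
qed

end
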